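(* Every $2$-dimensional indecomposable representation of $\mathcal{B}$ is isomorphic either to $\mathcal{U}_{a,b}$ for unique $a,b\in\Bbbk$, or to $\mathcal{V}_a$ for a unique $a\in\Bbbk^{\times}$, or to $\Bbbk^2_\lambda$ for a unique $\lambda\in\Bbbk$.
   Context: $\Bbbk$ is an algebraically closed field of characteristic $0$. The super Jordan plane $\mathcal{B}$ is the associative unital $\Bbbk$-algebra generated by $x_1,x_2$ with defining relations $x_1^2=0$ and $x_2x_{21}=x_{21}x_2+x_1x_{21}$, where $x_{21}:=x_1x_2+x_2x_1$. Write $X_1,X_2$ for the matrices by which $x_1,x_2$ act, and $E_{12}=\begin{pmatrix}0&1\\0&0\end{pmatrix}$. The following are $\mathcal{B}$-modules on $\Bbbk^2$: - $\mathcal{U}_{a,b}$ ($a,b\in\Bbbk$): $X_1=E_{12}$, $X_2=\begin{pmatrix}a&b\\0&a\end{pmatrix}$. - $\mathcal{V}_a$ ($a\in\Bbbk^\times$): $X_1=E_{12}$, $X_2=\begin{pmatrix}a&0\\0&-a\end{pmatrix}$. - $\Bbbk^2_\lambda$ ($\lambda\in\Bbbk$): $X_1=0$ and $X_2$ is the Jordan block of size $2$ with eigenvalue $\lambda$. *)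

theory Defs
  imports "HOL-Analysis.Analysis" "HOL-Library.Poly_Mapping"
begin

text \<open>The free algebra on \<open>x\<^sub>1, x\<^sub>2\<close> is the algebra of the free monoid on two letters: finitely
  supported functions on words, with the convolution product of \<^theory>\<open>HOL-Library.Poly_Mapping\<close>.
  That theory takes the monoid in additive notation, so \<open>+\<close> on words is concatenation.\<close>

datatype sjp_gen = G1 | G2

datatype word = Word (letters: "sjp_gen list")

instantiation word :: monoid_add
begin

definition zero_word :: word where
  "zero_word = Word []"

definition plus_word :: "word \<Rightarrow> word \<Rightarrow> word" where
  "plus_word u v = Word (letters u @ letters v)"

instance
  by standard (simp_all add: zero_word_def plus_word_def)

end

type_synonym 'k free_alg = "word \<Rightarrow>\<^sub>0 'k"

definition gen :: "sjp_gen \<Rightarrow> 'k::field free_alg" where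
  "gen g = Poly_Mapping.single (Word [g]) 1"

definition free_const :: "'k::field \<Rightarrow> 'k free_alg" where
  "free_const c = Poly_Mapping.single 0 c"

definition gen21 :: "'k::field free_alg" where
  "gen21 = gen G1 * gen G2 + gen G2 * gen G1"

text \<open>The two-sided ideal generated by the defining relations.\<close>

inductive_set sjp_ideal :: "'k::field free_alg set" where
  rel1: "gen G1 ^ 2 \<in> sjp_ideal"
| rel2: "gen G2 * gen21 - (gen21 * gen G2 + gen G1 * gen21) \<in> sjp_ideal"
| zero: "0 \<in> sjp_ideal"
| add: "p \<in> sjp_ideal \<Longrightarrow> q \<in> sjp_ideal \<Longrightarrow> p + q \<in> sjp_ideal"
| mult_left: "p \<in> sjp_ideal \<Longrightarrow> r * p \<in> sjp_ideal"
| mult_right: "p \<in> sjp_ideal \<Longrightarrow> p * r \<in> sjp_ideal"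

lemma sjp_ideal_uminus: "- p \<in> sjp_ideal" if "p \<in> sjp_ideal"
  using sjp_ideal.mult_left[OF that, of "-1"] by simp

lemma sjp_ideal_diff: "p - q \<in> sjp_ideal" if "p \<in> sjp_ideal" "q \<in> sjp_ideal"
  using sjp_ideal.add[OF that(1) sjp_ideal_uminus[OF that(2)]] by simp

text \<open>The action of the free algebra on \<open>k\<^sup>2\<close> for which \<open>x\<^sub>1, x\<^sub>2\<close> act by given matrices.\<close>

fun gen_mat :: "'k::field^2^2 \<Rightarrow> 'k^2^2 \<Rightarrow> sjp_gen \<Rightarrow> 'k^2^2" where
  "gen_mat X1 X2 G1 = X1"
| "gen_mat X1 X2 G2 = X2"

definition word_act :: "'k::field^2^2 \<Rightarrow> 'k^2^2 \<Rightarrow> word \<Rightarrow> 'k^2 \<Rightarrow> 'k^2" where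
  "word_act X1 X2 w v = foldr (\<lambda>g u. gen_mat X1 X2 g *v u) (letters w) v"

definition free_act :: "'k::field^2^2 \<Rightarrow> 'k^2^2 \<Rightarrow> 'k free_alg \<Rightarrow> 'k^2 \<Rightarrow> 'k^2" where
  "free_act X1 X2 p v =
     (\<Sum>w\<in>Poly_Mapping.keys p. Poly_Mapping.lookup p w *s word_act X1 X2 w v)"

lemma word_act_linear: "Vector_Spaces.linear (*s) (*s) (word_act X1 X2 w)"
proof -
  have "Vector_Spaces.linear (*s) (*s) (foldr (\<lambda>g u. gen_mat X1 X2 g *v u) ws)" for ws
  proof (induction ws)
    case Nil
    then show ?case
      by (simp add: vec.linear_ident)
  next
    case (Cons g ws)
    then show ?case
      using Vector_Spaces.linear_compose[OF Cons.IH matrix_vector_mul_linear_gen, of "gen_mat X1 X2 g"]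
      by (simp add: comp_def)
  qed
  then show ?thesis
    by (simp add: word_act_def[abs_def])
qed

lemma word_act_add: "word_act X1 X2 (u + w) v = word_act X1 X2 u (word_act X1 X2 w v)"
  by (simp add: word_act_def plus_word_def)

lemma word_act_0 [simp]: "word_act X1 X2 0 v = v"
  by (simp add: word_act_def zero_word_def)

lemma free_act_linear: "Vector_Spaces.linear (*s) (*s) (free_act X1 X2 p)"
proof -
  interpret w: Vector_Spaces.linear "(*s)" "(*s)" "word_act X1 X2 w" for w
    by (rule word_act_linear)
  show ?thesis
    by unfold_locales
      (simp_all add: free_act_def w.add w.scale vec.scale_right_distrib sum.distrib
        vec.scale_sum_right mult.commute)
qed

lemma free_act_add: "free_act X1 X2 (p + q) v = free_act X1 X2 p v + free_act X1 X2 q v"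
  unfolding free_act_def
  by (rule setsum_keys_plus_distrib) (simp_all add: vec.scale_left_distrib)

lemma free_act_single [simp]:
  "free_act X1 X2 (Poly_Mapping.single w c) v = c *s word_act X1 X2 w v"
  by (simp add: free_act_def)

lemma free_act_0 [simp]: "free_act X1 X2 0 v = 0"
  by (simp add: free_act_def)

lemma free_act_1 [simp]: "free_act X1 X2 1 v = v"
  by (simp flip: single_one)

lemma free_act_uminus: "free_act X1 X2 (- p) v = - free_act X1 X2 p v"
  using free_act_add[of X1 X2 p "- p" v] by (simp add: eq_neg_iff_add_eq_0 add.commute)

lemma free_act_diff: "free_act X1 X2 (p - q) v = free_act X1 X2 p v - free_act X1 X2 q v"
  using free_act_add[of X1 X2 p "- q" v] by (simp add: free_act_uminus)

lemma free_alg_induct [case_names single add]: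
  assumes single: "\<And>w c. P (Poly_Mapping.single w c)"
    and add: "\<And>p q. P p \<Longrightarrow> P q \<Longrightarrow> P (p + q)"
  shows "P (p :: 'k::field free_alg)"
proof (induction p rule: update_induct)
  case const
  then show ?case using single[of 0 0] by simp
next
  case (update f a b)
  have "Poly_Mapping.update a b f = f + Poly_Mapping.single a b"
    using update(1)
    by (intro poly_mapping_eqI)
      (auto simp: lookup_update lookup_add lookup_single when_def in_keys_iff)
  then show ?case
    using add[OF update(3) single] by simp
qed

lemma free_act_mult: "free_act X1 X2 (p * q) v = free_act X1 X2 p (free_act X1 X2 q v)"
proof (induction p rule: free_alg_induct)
  case (single w c)
  interpret w: Vector_Spaces.linear "(*s)" "(*s)" "word_act X1 X2 w"
    by (rule word_act_linear)
  show ?case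
    by (induction q rule: free_alg_induct)
      (simp_all add: mult_single word_act_add w.scale w.add free_act_add distrib_left
        vec.scale_right_distrib)
next
  case (add p q)
  then show ?case
    by (simp add: distrib_right free_act_add)
qed

lemma free_act_gen: "free_act X1 X2 (gen g) v = gen_mat X1 X2 g *v v"
  by (simp add: gen_def word_act_def)

definition sjp_relations :: "'k::field^2^2 \<Rightarrow> 'k^2^2 \<Rightarrow> bool" where
  "sjp_relations X1 X2 \<longleftrightarrow>
     (let X21 = X1 ** X2 + X2 ** X1 in X1 ** X1 = 0 \<and> X2 ** X21 = X21 ** X2 + X1 ** X21)"

lemma free_act_ideal:
  assumes "sjp_relations X1 X2" "p \<in> sjp_ideal"
  shows "free_act X1 X2 p v = 0"
  using assms(2)
proof (induction arbitrary: v)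
  case rel1
  have "X1 *v (X1 *v v) = 0"
    using assms(1) by (simp add: sjp_relations_def Let_def matrix_vector_mul_assoc)
  then show ?case
    by (simp add: power2_eq_square free_act_mult free_act_gen)
next
  case rel2
  have "free_act X1 X2 gen21 u = (X1 ** X2 + X2 ** X1) *v u" for u
    by (simp add: gen21_def free_act_add free_act_mult free_act_gen
        matrix_vector_mul_assoc matrix_vector_mult_add_rdistrib)
  then show ?case
    using assms(1)
    by (simp add: sjp_relations_def Let_def free_act_diff free_act_add free_act_mult free_act_gen
        matrix_vector_mul_assoc flip: matrix_vector_mult_add_rdistrib)
next
  case (mult_left p r)
  interpret r: Vector_Spaces.linear "(*s)" "(*s)" "free_act X1 X2 r"
    by (rule free_act_linear)
  from mult_left show ?case
    by (simp add: free_act_mult r.zero)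
qed (simp_all add: free_act_add free_act_mult)

lemma one_notin_sjp_ideal: "(1 :: 'k::field free_alg) \<notin> sjp_ideal"
proof
  assume "(1 :: 'k free_alg) \<in> sjp_ideal"
  moreover have "sjp_relations (0 :: 'k^2^2) 0"
    by (simp add: sjp_relations_def)
  ultimately have "(vec 1 :: 'k^2) = 0"
    using free_act_ideal free_act_1 by metis
  then show False
    by (simp add: vec_eq_iff)
qed

definition sjp_cong :: "'k::field free_alg \<Rightarrow> 'k free_alg \<Rightarrow> bool" where
  "sjp_cong p q \<longleftrightarrow> p - q \<in> sjp_ideal"

lemma sjp_cong_equivp: "equivp sjp_cong"
proof (rule equivpI)
  show "reflp sjp_cong"
    by (simp add: reflp_def sjp_cong_def sjp_ideal.zero)
  show "symp sjp_cong"
    unfolding symp_def sjp_cong_def by (metis minus_diff_eq sjp_ideal_uminus)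
  show "transp sjp_cong"
    unfolding transp_def sjp_cong_def by (metis diff_add_cancel add_diff_eq sjp_ideal.add)
qed

text \<open>The super Jordan plane.\<close>

quotient_type (overloaded) 'k sjp = "'k::field free_alg" / sjp_cong
  by (rule sjp_cong_equivp)

instantiation sjp :: (field) ring_1
begin

lift_definition zero_sjp :: "'a sjp" is 0 .
lift_definition one_sjp :: "'a sjp" is 1 .

lift_definition plus_sjp :: "'a sjp \<Rightarrow> 'a sjp \<Rightarrow> 'a sjp" is "(+)"
  unfolding sjp_cong_def by (metis add_diff_add sjp_ideal.add)

lift_definition uminus_sjp :: "'a sjp \<Rightarrow> 'a sjp" is uminus
  unfolding sjp_cong_def by (metis minus_diff_minus sjp_ideal_uminus)

lift_definition minus_sjp :: "'a sjp \<Rightarrow> 'a sjp \<Rightarrow> 'a sjp" is "(-)"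
  unfolding sjp_cong_def
  by (metis (no_types, lifting) diff_diff_eq2 diff_diff_eq diff_add_eq add.commute sjp_ideal_diff)

lift_definition times_sjp :: "'a sjp \<Rightarrow> 'a sjp \<Rightarrow> 'a sjp" is "(*)"
proof -
  fix p p' q q' :: "'a free_alg"
  assume "sjp_cong p p'" "sjp_cong q q'"
  then have "(p - p') * q + p' * (q - q') \<in> sjp_ideal"
    unfolding sjp_cong_def by (intro sjp_ideal.add sjp_ideal.mult_left sjp_ideal.mult_right)
  then show "sjp_cong (p * q) (p' * q')"
    by (simp add: sjp_cong_def algebra_simps)
qed

instance
proof
  show "(0::'a sjp) \<noteq> 1"
    by transfer (metis diff_0 minus_minus one_notin_sjp_ideal sjp_cong_def sjp_ideal_uminus)
qed (transfer; simp add: sjp_cong_def sjp_ideal.zero algebra_simps)+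

end

lift_definition x1 :: "'k::field sjp" is "gen G1" .
lift_definition x2 :: "'k::field sjp" is "gen G2" .

lift_definition sjp_const :: "'k::field \<Rightarrow> 'k sjp" is free_const .

definition x21 :: "'k::field sjp" where
  "x21 = x1 * x2 + x2 * x1"

lemma x1_square: "x1 ^ 2 = 0"
  unfolding power2_eq_square
  by transfer (simp add: sjp_cong_def sjp_ideal.rel1 flip: power2_eq_square)

lemma x2_x21: "x2 * x21 = x21 * x2 + x1 * x21"
  unfolding x21_def
  by transfer (use sjp_ideal.rel2 in \<open>simp add: sjp_cong_def gen21_def\<close>)

text \<open>Representations are left modules: a unital \<open>k\<close>-algebra homomorphism from the super Jordan
  plane to the endomorphisms of a vector space with scalar multiplication \<open>scale\<close>.\<close>

locale sjp_rep = vector_space scale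
  for scale :: "'k::field \<Rightarrow> 'v::ab_group_add \<Rightarrow> 'v" +
  fixes act :: "'k sjp \<Rightarrow> 'v \<Rightarrow> 'v"
  assumes act_linear: "Vector_Spaces.linear scale scale (act b)"
    and act_add: "act (b + c) v = act b v + act c v"
    and act_mult: "act (b * c) v = act b (act c v)"
    and act_one: "act 1 v = v"
    and act_const: "act (sjp_const t) v = scale t v"
begin

definition subrep :: "'v set \<Rightarrow> bool" where
  "subrep W \<longleftrightarrow> subspace W \<and> (\<forall>b. \<forall>w\<in>W. act b w \<in> W)"

definition indecomposable :: bool where
  "indecomposable \<longleftrightarrow>
     (UNIV :: 'v set) \<noteq> {0} \<and>
     (\<forall>W1 W2. subrep W1 \<longrightarrow> subrep W2 \<longrightarrow> W1 \<inter> W2 = {0} \<longrightarrow> {u + w | u w. u \<in> W1 \<and> w \<in> W2} = UNIV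
        \<longrightarrow> W1 = {0} \<or> W2 = {0})"

end

definition rep_iso ::
  "('k::field \<Rightarrow> 'v::ab_group_add \<Rightarrow> 'v) \<Rightarrow> ('k sjp \<Rightarrow> 'v \<Rightarrow> 'v) \<Rightarrow>
   ('k \<Rightarrow> 'w::ab_group_add \<Rightarrow> 'w) \<Rightarrow> ('k sjp \<Rightarrow> 'w \<Rightarrow> 'w) \<Rightarrow> bool" where
  "rep_iso scaleV actV scaleW actW \<longleftrightarrow>
     (\<exists>f. Vector_Spaces.linear scaleV scaleW f \<and> bij f \<and> (\<forall>b v. f (actV b v) = actW b (f v)))"

text \<open>The module on \<open>k\<^sup>2\<close> for which \<open>x\<^sub>1, x\<^sub>2\<close> act by given matrices. Evaluating at the chosen
  representative is meaningful only if the matrices satisfy the defining relations; the following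
  lemmas show that it is then independent of the representative.\<close>

definition mat_rep :: "'k::field^2^2 \<Rightarrow> 'k^2^2 \<Rightarrow> 'k sjp \<Rightarrow> 'k^2 \<Rightarrow> 'k^2" where
  "mat_rep X1 X2 b = free_act X1 X2 (rep_sjp b)"

lemma mat_rep_abs:
  assumes "sjp_relations X1 X2"
  shows "mat_rep X1 X2 (abs_sjp p) = free_act X1 X2 p"
proof
  fix v
  have "sjp_cong (rep_sjp (abs_sjp p)) p"
    by (rule rep_abs_rsp_left[OF Quotient3_sjp]) (simp add: sjp_cong_def sjp_ideal.zero)
  then have "free_act X1 X2 (rep_sjp (abs_sjp p) - p) v = 0"
    using free_act_ideal[OF assms] by (simp add: sjp_cong_def)
  then show "mat_rep X1 X2 (abs_sjp p) v = free_act X1 X2 p v"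
    by (simp add: mat_rep_def free_act_diff)
qed

lemma mat_rep_is_rep:
  assumes "sjp_relations X1 X2"
  shows "sjp_rep (*s) (mat_rep X1 X2)"
proof (intro sjp_rep.intro sjp_rep_axioms.intro vec.vector_space_axioms)
  show "Vector_Spaces.linear (*s) (*s) (mat_rep X1 X2 b)" for b
    using free_act_linear by (simp add: mat_rep_def[abs_def])
  fix b c :: "'a sjp" and t :: 'a and v
  obtain p q where bc: "b = abs_sjp p" "c = abs_sjp q"
    by (metis Quotient3_sjp Quotient3_abs_rep)
  show "mat_rep X1 X2 (b + c) v = mat_rep X1 X2 b v + mat_rep X1 X2 c v"
    by (simp add: bc plus_sjp.abs_eq mat_rep_abs[OF assms] free_act_add)
  show "mat_rep X1 X2 (b * c) v = mat_rep X1 X2 b (mat_rep X1 X2 c v)"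
    by (simp add: bc times_sjp.abs_eq mat_rep_abs[OF assms] free_act_mult)
  show "mat_rep X1 X2 1 v = v"
    by (simp add: one_sjp.abs_eq mat_rep_abs[OF assms])
  show "mat_rep X1 X2 (sjp_const t) v = t *s v"
    by (simp add: sjp_const.abs_eq free_const_def mat_rep_abs[OF assms])
qed

lemma mat_rep_gens:
  assumes "sjp_relations X1 X2"
  shows "mat_rep X1 X2 x1 v = X1 *v v" "mat_rep X1 X2 x2 v = X2 *v v"
  by (simp_all add: x1.abs_eq x2.abs_eq mat_rep_abs[OF assms] free_act_gen)

text \<open>The matrix with rows \<open>(p, q)\<close> and \<open>(r, s)\<close>.\<close>

definition mat2 :: "'k::field \<Rightarrow> 'k \<Rightarrow> 'k \<Rightarrow> 'k \<Rightarrow> 'k^2^2" where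
  "mat2 p q r s = vector [vector [p, q], vector [r, s]]"

definition E12 :: "'k::field^2^2" where
  "E12 = mat2 0 1 0 0"

definition U_rep :: "'k::field \<Rightarrow> 'k \<Rightarrow> 'k sjp \<Rightarrow> 'k^2 \<Rightarrow> 'k^2" where
  "U_rep a b = mat_rep E12 (mat2 a b 0 a)"

definition V_rep :: "'k::field \<Rightarrow> 'k sjp \<Rightarrow> 'k^2 \<Rightarrow> 'k^2" where
  "V_rep a = mat_rep E12 (mat2 a 0 0 (- a))"

definition Jordan_rep :: "'k::field \<Rightarrow> 'k sjp \<Rightarrow> 'k^2 \<Rightarrow> 'k^2" where
  "Jordan_rep l = mat_rep 0 (mat2 l 1 0 l)"

lemma mat2_mult:
  "mat2 p q r s ** mat2 p' q' r' s' =
     mat2 (p * p' + q * r') (p * q' + q * s') (r * p' + s * r') (r * q' + s * s')"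
  by (simp add: mat2_def matrix_matrix_mult_def vec_eq_iff forall_2 sum_2)

lemma mat2_add: "mat2 p q r s + mat2 p' q' r' s' = mat2 (p + p') (q + q') (r + r') (s + s')"
  by (simp add: mat2_def vec_eq_iff forall_2)

lemma mat2_0: "mat2 0 0 0 0 = 0"
  by (simp add: mat2_def vec_eq_iff forall_2)

lemma relations_U: "sjp_relations E12 (mat2 a b 0 a)"
  and relations_V: "sjp_relations E12 (mat2 a 0 0 (- a))"
  and relations_Jordan: "sjp_relations 0 (mat2 l 1 0 l)"
  by (simp_all add: sjp_relations_def E12_def mat2_mult mat2_add Let_def
      algebra_simps flip: mat2_0)

lemma U_rep: "sjp_rep (*s) (U_rep a b)"
  and V_rep: "sjp_rep (*s) (V_rep a)"
  and Jordan_rep: "sjp_rep (*s) (Jordan_rep l)"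
  unfolding U_rep_def V_rep_def Jordan_rep_def
  by (intro mat_rep_is_rep relations_U relations_V relations_Jordan)+

end

theory Submission
  imports Defs
begin

text \<open>If \<open>x\<^sub>1\<close> acts nontrivially, take \<open>v\<close> with \<open>e = x\<^sub>1 v \<noteq> 0\<close>. In the basis \<open>e, v\<close> the generator \<open>x\<^sub>1\<close>
  acts by \<open>E12\<close>, and if \<open>x\<^sub>2\<close> acts by the matrix with rows \<open>(p, q)\<close> and \<open>(r, s)\<close>, the second
  relation becomes \<open>r = 0\<close> and \<open>(p + s) * (p - s) = 0\<close>. The case \<open>p = s\<close> is \<open>U\<close>; if \<open>s = - p \<noteq> 0\<close>,
  replacing \<open>v\<close> by a suitable \<open>v + c e\<close> makes \<open>q\<close> vanish and gives \<open>V\<close>. If \<open>x\<^sub>1\<close> acts by zero,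
  submodules are the \<open>x\<^sub>2\<close>-invariant subspaces and indecomposability leaves one Jordan block.

  The families and their parameters are told apart by isomorphism-invariant identities:
  \<open>x\<^sub>2 = a + b x\<^sub>1\<close> on \<open>U\<close>; \<open>x\<^sub>2 x\<^sub>1 = a x\<^sub>1 = - x\<^sub>1 x\<^sub>2\<close> on \<open>V\<close>; \<open>x\<^sub>1 = 0\<close> and \<open>(x\<^sub>2 - l)\<^sup>2 = 0\<close> on a
  Jordan block.\<close>

section \<open>Induction over the super Jordan plane\<close>

text \<open>Every class is a linear combination of words, and words are products of generators.
  Claims about the action of all \<open>b\<close> thus reduce to constants, \<open>x1\<close> and
  \<open>x2\<close>.\<close>

lemma sjp_induct [case_names const x1 x2 add mult]:
  assumes const: "\<And>t. P (sjp_const t)"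
    and x1: "P x1" and x2: "P x2"
    and add: "\<And>b c. P b \<Longrightarrow> P c \<Longrightarrow> P (b + c)"
    and mult: "\<And>b c. P b \<Longrightarrow> P c \<Longrightarrow> P (b * c)"
  shows "P (b :: 'k::field sjp)"
proof -
  have word: "P (abs_sjp (Poly_Mapping.single (Word gs) 1))" for gs
  proof (induction gs)
    case Nil
    then show ?case
      using const[of 1] by (simp add: sjp_const.abs_eq free_const_def zero_word_def)
  next
    case (Cons g gs)
    \<comment> \<open>Addition of words is concatenation, so monomials multiply by adding their
      words.\<close>
    have "Word (g # gs) = Word [g] + Word gs"
      by (simp add: plus_word_def)
    then have "abs_sjp (Poly_Mapping.single (Word (g # gs)) (1::'k)) =
        abs_sjp (gen g) * abs_sjp (Poly_Mapping.single (Word gs) 1)"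
      by (simp add: times_sjp.abs_eq gen_def mult_single)
    moreover have "P (abs_sjp (gen g))"
      using x1 x2 by (cases g) (simp_all add: x1.abs_eq x2.abs_eq)
    ultimately show ?case
      using mult Cons.IH by simp
  qed
  have "P (abs_sjp p)" for p
  proof (induction p rule: free_alg_induct)
    case (single w c)
    have "abs_sjp (Poly_Mapping.single w c) = sjp_const c * abs_sjp (Poly_Mapping.single w 1)"
      by (simp add: sjp_const.abs_eq free_const_def times_sjp.abs_eq mult_single)
    then show ?case
      using mult const word by (cases w) simp
  next
    case (add p q)
    then show ?case
      using assms(4) by (simp flip: plus_sjp.abs_eq)
  qed
  then show ?thesis
    by (metis Quotient3_sjp Quotient3_abs_rep)
qed

lemma mat2_mult_vec: "mat2 p q r s *v u = vector [p * u $ 1 + q * u $ 2, r * u $ 1 + s * u $ 2]"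
  by (simp add: mat2_def matrix_vector_mult_def vec_eq_iff forall_2 sum_2)

lemma rep_isoE:
  assumes "rep_iso scaleV actV scaleW actW"
  obtains f where "Vector_Spaces.linear scaleV scaleW f" "bij f"
    "\<And>b v. f (actV b v) = actW b (f v)"
  using assms unfolding rep_iso_def by blast

section \<open>Linearity of the action and the defining relations on vectors\<close>

context sjp_rep
begin

lemma act_plus [simp]: "act b (u + v) = act b u + act b v"
  and act_scale [simp]: "act b (scale c v) = scale c (act b v)"
  and act_0 [simp]: "act b 0 = 0"
  and act_diff [simp]: "act b (u - v) = act b u - act b v"
proof -
  interpret l: Vector_Spaces.linear scale scale "act b"
    by (rule act_linear)
  show "act b (u + v) = act b u + act b v" "act b (scale c v) = scale c (act b v)"
    "act b 0 = 0" "act b (u - v) = act b u - act b v"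
    by (simp_all add: l.add l.scale l.diff)
qed

lemma act_zero [simp]: "act 0 v = 0"
  using act_add[of 0 0 v] by simp

lemma act_x1_x1 [simp]: "act x1 (act x1 v) = 0"
  using arg_cong[OF x1_square, of "\<lambda>b. act b v"] by (simp add: power2_eq_square act_mult)

lemma act_x21: "act x21 v = act x1 (act x2 v) + act x2 (act x1 v)"
  by (simp add: x21_def act_add act_mult)

lemma act_x2_x21: "act x2 (act x21 v) = act x21 (act x2 v) + act x1 (act x21 v)"
  using arg_cong[OF x2_x21, of "\<lambda>b. act b v"] by (simp add: act_add act_mult)

section \<open>Coordinates with respect to two vectors\<close>

definition lincomb :: "'v \<Rightarrow> 'v \<Rightarrow> 'k^2 \<Rightarrow> 'v" where
  "lincomb e1 e2 u = scale (u $ 1) e1 + scale (u $ 2) e2"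

lemma lincomb_vector [simp]: "lincomb e1 e2 (vector [c, d]) = scale c e1 + scale d e2"
  by (simp add: lincomb_def)

lemma bij_lincomb:
  assumes dim: "dim (UNIV :: 'v set) = 2"
    and e1: "e1 \<noteq> 0" and e2: "\<And>c. e2 \<noteq> scale c e1"
  shows "bij (lincomb e1 e2)"
proof -
  have "e2 \<notin> span {e1}"
    using e2 by (auto simp: span_singleton)
  then have ind: "independent {e2, e1}"
    using e1 by (simp add: independent_insert)
  have "e1 \<noteq> e2"
    using e2[of 1] by auto
  \<comment> \<open>A finite basis makes the finite-dimensional theory applicable; counting then
    shows that the independent pair spans.\<close>
  obtain B where B: "independent B" "UNIV \<subseteq> span B" "card B = 2"
    using basis_exists[of UNIV] dim by metis
  then have "finite B"
    by (simp add: card_ge_0_finite)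
  then interpret fd: finite_dimensional_vector_space scale B
    using B by unfold_locales auto
  have sp: "UNIV \<subseteq> span {e2, e1}"
    using fd.card_ge_dim_independent[of "{e2, e1}" UNIV] ind dim \<open>e1 \<noteq> e2\<close> by simp
  have "surj (lincomb e1 e2)"
  proof (rule surjI)
    fix v
    show "lincomb e1 e2 (SOME u. lincomb e1 e2 u = v) = v"
    proof (rule someI_ex)
      have "v \<in> span {e2, e1}"
        using sp by auto
      then obtain d c where "v - scale d e2 = scale c e1"
        by (auto simp: span_breakdown_eq[of v e2] span_singleton)
      then have "lincomb e1 e2 (vector [c, d]) = v"
        by (simp add: algebra_simps)
      then show "\<exists>u. lincomb e1 e2 u = v" ..
    qed
  qed
  moreover have "inj (lincomb e1 e2)"
  proof (rule injI)
    fix u w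
    assume "lincomb e1 e2 u = lincomb e1 e2 w"
    then have eq: "scale (w $ 2 - u $ 2) e2 = scale (u $ 1 - w $ 1) e1"
      by (simp add: lincomb_def algebra_simps)
    have 2: "w $ 2 = u $ 2"
    proof (rule ccontr)
      assume "w $ 2 \<noteq> u $ 2"
      then have "e2 = scale (inverse (w $ 2 - u $ 2)) (scale (w $ 2 - u $ 2) e2)"
        by simp
      then show False
        using e2 unfolding eq by simp
    qed
    with eq e1 show "u = w"
      by (simp add: vec_eq_iff forall_2)
  qed
  ultimately show ?thesis
    by (simp add: bij_def)
qed

lemma lincombE:
  assumes "bij (lincomb e1 e2)"
  obtains c d where "v = scale c e1 + scale d e2"
proof -
  obtain u where "v = lincomb e1 e2 u"
    using surjD[OF bij_is_surj[OF assms], of v] by blast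
  then show thesis
    using that unfolding lincomb_def by blast
qed

lemma lincomb_eq_iff:
  assumes "bij (lincomb e1 e2)"
  shows "scale c e1 + scale d e2 = scale c' e1 + scale d' e2 \<longleftrightarrow> c = c' \<and> d = d'"
proof
  assume "scale c e1 + scale d e2 = scale c' e1 + scale d' e2"
  then have "lincomb e1 e2 (vector [c, d]) = lincomb e1 e2 (vector [c', d'])"
    by simp
  then have "vector [c, d] = (vector [c', d'] :: 'k^2)"
    using bij_is_inj[OF assms] by (simp only: inj_eq)
  then show "c = c' \<and> d = d'"
    by (simp add: vec_eq_iff forall_2)
qed simp

text \<open>The hypotheses on \<open>act\<close> give the columns of the two matrices in the basis
  \<open>e1\<close>, \<open>e2\<close>. The coordinate map then commutes with the generators, hence
  with the whole algebra.\<close>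

lemma rep_iso_mat_rep:
  assumes bij: "bij (lincomb e1 e2)"
    and rel: "sjp_relations (mat2 p q r s) (mat2 p' q' r' s')"
    and x1: "act x1 e1 = scale p e1 + scale r e2" "act x1 e2 = scale q e1 + scale s e2"
    and x2: "act x2 e1 = scale p' e1 + scale r' e2" "act x2 e2 = scale q' e1 + scale s' e2"
  shows "rep_iso scale act (*s) (mat_rep (mat2 p q r s) (mat2 p' q' r' s'))"
proof -
  define g where "g = lincomb e1 e2"
  interpret m: sjp_rep "(*s)" "mat_rep (mat2 p q r s) (mat2 p' q' r' s')"
    by (rule mat_rep_is_rep[OF rel])
  have g_add: "g (u + w) = g u + g w" and g_scale: "g (c *s u) = scale c (g u)" for u w c
    by (simp_all add: g_def lincomb_def algebra_simps)
  have g_act: "g (mat_rep (mat2 p q r s) (mat2 p' q' r' s') b u) = act b (g u)" for b u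
  proof (induction b arbitrary: u rule: sjp_induct)
    case (const t)
    show ?case by (simp add: act_const m.act_const g_scale)
  next
    case x1
    show ?case by (simp add: mat_rep_gens[OF rel] mat2_mult_vec g_def lincomb_def assms algebra_simps)
  next
    case x2
    show ?case by (simp add: mat_rep_gens[OF rel] mat2_mult_vec g_def lincomb_def assms algebra_simps)
  next
    case (add b c)
    then show ?case by (simp add: act_add m.act_add g_add)
  next
    case (mult b c)
    then show ?case by (simp add: act_mult m.act_mult)
  qed
  \<comment> \<open>\<open>g\<close> goes from the matrix module to the given one, while
    \<open>rep_iso\<close> asks for the opposite direction.\<close>
  define f where "f = inv g"
  have fg: "f (g u) = u" and gf: "g (f v) = v" for u v
    using bij by (simp_all add: f_def g_def bij_is_inj bij_is_surj surj_f_inv_f)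
  have "f (v + w) = f v + f w" for v w
    by (metis fg gf g_add)
  moreover have "f (scale c v) = c *s f v" for c v
    by (metis fg gf g_scale)
  ultimately have "Vector_Spaces.linear scale (*s) f"
    by (simp add: Vector_Spaces.linear_iff vector_space_axioms vec.vector_space_axioms)
  moreover have "bij f"
    using bij by (simp add: f_def g_def bij_imp_bij_inv)
  moreover have "f (act b v) = mat_rep (mat2 p q r s) (mat2 p' q' r' s') b (f v)" for b v
    by (metis fg gf g_act)
  ultimately show ?thesis
    unfolding rep_iso_def by blast
qed

section \<open>Common eigenvectors and direct sum decompositions\<close>

text \<open>Being an eigenvector passes to sums and products of operators, so a common eigenvector
  of the generators is one for every \<open>b\<close>.\<close>

lemma subrep_span_eigenvector:
  assumes "act x1 v = scale c v" "act x2 v = scale d v"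
  shows "subrep (span {v})"
proof -
  have ev: "\<exists>c. act b v = scale c v" for b
  proof (induction b rule: sjp_induct)
    case (const t)
    show ?case by (auto simp: act_const)
  next
    case (add b c)
    then show ?case by (auto simp: act_add simp flip: scale_left_distrib)
  next
    case (mult b c)
    then show ?case by (auto simp: act_mult)
  qed (use assms in auto)
  show ?thesis
    unfolding subrep_def
  proof (intro conjI allI ballI)
    show "subspace (span {v})"
      by (rule subspace_span)
    fix b w
    assume "w \<in> span {v}"
    then obtain k where "w = scale k v"
      by (auto simp: span_singleton)
    moreover obtain c where "act b v = scale c v"
      using ev by blast
    ultimately show "act b w \<in> span {v}"
      by (simp add: span_base span_scale)
  qed
qed

text \<open>The lines through \<open>e1\<close> and \<open>e2\<close> are complementary nonzero
  submodules.\<close>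

lemma not_indecomposable_eigenbasis:
  assumes bij: "bij (lincomb e1 e2)"
    and 1: "act x1 e1 = scale a1 e1" "act x2 e1 = scale b1 e1"
    and 2: "act x1 e2 = scale a2 e2" "act x2 e2 = scale b2 e2"
  shows "\<not> indecomposable"
proof -
  have e: "e1 \<noteq> 0" "e2 \<noteq> 0"
    using lincomb_eq_iff[OF bij, of 1 0 0 0] lincomb_eq_iff[OF bij, of 0 1 0 0] by auto
  have "span {e1} \<inter> span {e2} = {0}"
  proof -
    have "scale c e1 = scale d e2 \<longleftrightarrow> c = 0 \<and> d = 0" for c d
      using lincomb_eq_iff[OF bij, of c 0 0 d] by auto
    then show ?thesis by (auto simp: span_singleton span_zero)
  qed
  moreover have "{u + w | u w. u \<in> span {e1} \<and> w \<in> span {e2}} = UNIV"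
  proof -
    have "\<exists>u w. v = u + w \<and> u \<in> span {e1} \<and> w \<in> span {e2}" for v
      using lincombE[OF bij, of v] by (metis singletonI span_base span_scale)
    then show ?thesis by blast
  qed
  moreover have "span {e1} \<noteq> {0}" "span {e2} \<noteq> {0}"
    using e by (metis singletonD singletonI span_base)+
  ultimately show ?thesis
    unfolding indecomposable_def
    using subrep_span_eigenvector[OF 1] subrep_span_eigenvector[OF 2] by blast
qed

section \<open>Existence of an isomorphism to a listed module\<close>

lemma rep_iso_U_or_V:
  assumes dim: "dim (UNIV :: 'v set) = 2" and two: "(2 :: 'k) \<noteq> 0"
    and v: "act x1 v \<noteq> 0"
  shows "(\<exists>a b. rep_iso scale act (*s) (U_rep a b)) \<or>
    (\<exists>a. a \<noteq> 0 \<and> rep_iso scale act (*s) (V_rep a))"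
proof -
  define e where "e = act x1 v"
  have N: "act x1 v = e" "act x1 e = 0" and "e \<noteq> 0"
    using v by (simp_all add: e_def)
  \<comment> \<open>Applying \<open>x1\<close> to \<open>v = scale c e\<close> would give
    \<open>e = 0\<close>.\<close>
  have v_neq: "v \<noteq> scale c e" for c
    using N \<open>e \<noteq> 0\<close> by (metis act_scale scale_zero_right)
  note bij = bij_lincomb[OF dim \<open>e \<noteq> 0\<close> v_neq]
  obtain p r where Te: "act x2 e = scale p e + scale r v"
    using lincombE[OF bij] by blast
  obtain q s where Tv: "act x2 v = scale q e + scale s v"
    using lincombE[OF bij] by blast
  have x21_e: "act x21 e = scale r e"
    by (simp add: act_x21 N Te)
  have x21_v: "act x21 v = scale (p + s) e + scale r v"
    by (simp add: act_x21 N Te Tv scale_left_distrib)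
  \<comment> \<open>The second relation at \<open>e\<close>; all other terms cancel.\<close>
  have "scale (r * (p + s)) e = 0"
    using act_x2_x21[of e] by (simp add: x21_e x21_v N Te scale_right_distrib mult.commute)
  then have rt: "r * (p + s) = 0"
    using \<open>e \<noteq> 0\<close> by simp
  have "act x2 (act x21 v) =
      scale ((p + s) * p + r * q) e + scale ((p + s) * r + r * s) v"
    by (simp only: x21_v act_plus act_scale Te Tv scale_scale distrib_right scale_left_distrib
        scale_right_distrib add_ac)
  moreover have "act x21 (act x2 v) + act x1 (act x21 v) =
      scale (q * r + s * (p + s) + r) e + scale (s * r) v"
    by (simp only: x21_e x21_v N Tv act_plus act_scale scale_scale distrib_left scale_left_distrib
        scale_right_distrib scale_zero_right add_0_left add_ac)
  ultimately have "scale ((p + s) * p + r * q) e + scale ((p + s) * r + r * s) v =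
      scale (q * r + s * (p + s) + r) e + scale (s * r) v"
    using act_x2_x21[of v] by simp
  \<comment> \<open>The second relation at \<open>v\<close>, read off in the coefficient of
    \<open>e\<close>.\<close>
  then have "(p + s) * p = s * (p + s) + r"
    unfolding lincomb_eq_iff[OF bij] by (simp add: mult.commute)
  then have r: "r = (p + s) * (p - s)"
    by (simp add: algebra_simps)
  \<comment> \<open>If the factor \<open>p + s\<close> in \<open>rt\<close> vanishes, the formula
    for \<open>r\<close> vanishes too.\<close>
  with rt have "r = 0"
    by (metis mult_eq_0_iff)
  with r have ps: "p + s = 0 \<or> p = s"
    by simp
  show ?thesis
  proof (cases "p = s")
    case True
    then have "rep_iso scale act (*s) (U_rep p q)"
      unfolding U_rep_def E12_def
      using relations_U[of p q, unfolded E12_def] N Te Tv \<open>r = 0\<close>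
      by (intro rep_iso_mat_rep[OF bij]) simp_all
    then show ?thesis by blast
  next
    case False
    with ps have s: "s = - p"
      by (simp add: eq_neg_iff_add_eq_0 add.commute)
    with False have "p \<noteq> 0"
      by auto
    \<comment> \<open>The solution of \<open>q + c * p = - p * c\<close>, which says that
      \<open>v + c e\<close> is an eigenvector of \<open>x2\<close> for \<open>- p\<close>. Adding a
      multiple of \<open>e\<close> leaves the image under \<open>x1\<close> equal to
      \<open>e\<close>.\<close>
    define c where "c = - q / (2 * p)"
    have c: "q + c * p = - p * c"
      using \<open>p \<noteq> 0\<close> two by (simp add: c_def field_simps)
    define w where "w = v + scale c e"
    have w_neq: "w \<noteq> scale d e" for d
      using v_neq[of "d - c"] by (simp add: w_def algebra_simps)
    have "act x2 w = scale (q + c * p) e + scale (- p) v"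
      by (simp add: w_def Te Tv s \<open>r = 0\<close> algebra_simps)
    then have "act x2 w = scale (- p) w"
      unfolding c by (simp add: w_def algebra_simps)
    moreover have "act x1 w = e"
      by (simp add: w_def N)
    ultimately have "rep_iso scale act (*s) (V_rep p)"
      unfolding V_rep_def E12_def
      using relations_V[of p, unfolded E12_def] N Te \<open>r = 0\<close>
      by (intro rep_iso_mat_rep[OF bij_lincomb[OF dim \<open>e \<noteq> 0\<close> w_neq]]) simp_all
    with \<open>p \<noteq> 0\<close> show ?thesis by blast
  qed
qed

text \<open>Completing \<open>e\<close> to a basis makes \<open>x2\<close> upper triangular.
  Distinct diagonal entries, or a zero entry above the diagonal, would give an eigenbasis and hence
  a decomposition.\<close>

lemma rep_iso_Jordan:
  assumes dim: "dim (UNIV :: 'v set) = 2" and ind: indecomposable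
    and x1: "\<And>v. act x1 v = 0"
    and e: "e \<noteq> 0" "act x2 e = scale l e"
  shows "rep_iso scale act (*s) (Jordan_rep l)"
proof -
  have "\<exists>v. \<forall>c. v \<noteq> scale c e"
  proof (rule ccontr)
    assume "\<nexists>v. \<forall>c. v \<noteq> scale c e"
    then have "UNIV \<subseteq> span {e}"
      by (auto simp: span_singleton)
    then have "dim UNIV \<le> card {e}"
      by (intro dim_le_card) auto
    with dim show False by simp
  qed
  then obtain v where v: "\<And>c. v \<noteq> scale c e" by blast
  note bij = bij_lincomb[OF dim e(1) v]
  obtain q s where Tv: "act x2 v = scale q e + scale s v"
    using lincombE[OF bij] by blast
  have "s = l"
  proof (rule ccontr)
    assume "s \<noteq> l"
    \<comment> \<open>Chosen so that \<open>v + c e\<close> is an eigenvector of \<open>x2\<close>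
      for \<open>s\<close>.\<close>
    define c where "c = q / (s - l)"
    have c: "q + c * l = s * c"
      using \<open>s \<noteq> l\<close> by (simp add: c_def field_simps)
    define w where "w = v + scale c e"
    have w: "w \<noteq> scale d e" for d
      using v[of "d - c"] by (simp add: w_def algebra_simps)
    have "act x2 w = scale (q + c * l) e + scale s v"
      by (simp add: w_def e Tv algebra_simps)
    then have "act x2 w = scale s w"
      unfolding c by (simp add: w_def algebra_simps)
    then show False
      using not_indecomposable_eigenbasis[OF bij_lincomb[OF dim e(1) w], of 0 l 0 s] ind e x1 by simp
  qed
  have "q \<noteq> 0"
    using not_indecomposable_eigenbasis[OF bij, of 0 l 0 l] ind e x1 Tv \<open>s = l\<close> by auto
  \<comment> \<open>Replacing \<open>e\<close> by \<open>scale q e\<close> normalises the entry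
    above the diagonal to 1.\<close>
  have v': "v \<noteq> scale c (scale q e)" for c
    using v by simp
  have qe: "scale q e \<noteq> 0"
    using \<open>q \<noteq> 0\<close> e by simp
  have "rep_iso scale act (*s) (mat_rep (mat2 0 0 0 0) (mat2 l 1 0 l))"
    using relations_Jordan[of l] x1 e Tv \<open>s = l\<close>
    by (intro rep_iso_mat_rep[OF bij_lincomb[OF dim qe v']]) (simp_all add: mat2_0 mult.commute)
  then show ?thesis
    by (simp add: Jordan_rep_def mat2_0)
qed

section \<open>Identities preserved by isomorphism\<close>

text \<open>The identity is checked in coordinates on the matrix module and pulled back along the
  injective \<open>f\<close>.\<close>

lemma rep_iso_UD:
  assumes "rep_iso scale act (*s) (U_rep a b)"
  shows "\<exists>v. act x1 v \<noteq> 0" "act x2 v = scale a v + scale b (act x1 v)"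
proof -
  obtain f where lin: "Vector_Spaces.linear scale (*s) f" and "bij f"
    and f: "\<And>b' v. f (act b' v) = U_rep a b b' (f v)"
    using rep_isoE[OF assms] by blast
  interpret l: Vector_Spaces.linear scale "(*s)" f by (rule lin)
  note f' = f[unfolded U_rep_def E12_def] mat_rep_gens[OF relations_U, unfolded E12_def] mat2_mult_vec
  have "f (act x2 v) = f (scale a v + scale b (act x1 v))"
    by (simp add: l.add l.scale f' vec_eq_iff forall_2)
  then show "act x2 v = scale a v + scale b (act x1 v)"
    using \<open>bij f\<close> by (metis bij_pointE)
  \<comment> \<open>\<open>E12\<close> sends the second basis vector to the first, so
    \<open>x1\<close> does not kill this \<open>v\<close>.\<close>
  obtain v where "f v = vector [0, 1]"
    using \<open>bij f\<close> by (metis bij_pointE)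
  then have "f (act x1 v) \<noteq> f 0"
    by (simp add: f' vec_eq_iff forall_2)
  then show "\<exists>v. act x1 v \<noteq> 0" by metis
qed

lemma rep_iso_VD:
  assumes "rep_iso scale act (*s) (V_rep a)"
  shows "\<exists>v. act x1 v \<noteq> 0" "act x2 (act x1 v) = scale a (act x1 v)"
    "act x1 (act x2 v) = scale (- a) (act x1 v)"
proof -
  obtain f where lin: "Vector_Spaces.linear scale (*s) f" and "bij f"
    and f: "\<And>b' v. f (act b' v) = V_rep a b' (f v)"
    using rep_isoE[OF assms] by blast
  interpret l: Vector_Spaces.linear scale "(*s)" f by (rule lin)
  note f' = f[unfolded V_rep_def E12_def] mat_rep_gens[OF relations_V, unfolded E12_def] mat2_mult_vec
  have "f (act x2 (act x1 v)) = f (scale a (act x1 v))"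
    by (simp add: l.add l.scale f' vec_eq_iff forall_2)
  then show "act x2 (act x1 v) = scale a (act x1 v)"
    using \<open>bij f\<close> by (metis bij_pointE)
  have "f (act x1 (act x2 v)) = f (scale (- a) (act x1 v))"
    by (simp only: l.scale f') (simp add: vec_eq_iff forall_2)
  then show "act x1 (act x2 v) = scale (- a) (act x1 v)"
    using \<open>bij f\<close> by (metis bij_pointE)
  obtain v where "f v = vector [0, 1]"
    using \<open>bij f\<close> by (metis bij_pointE)
  then have "f (act x1 v) \<noteq> f 0"
    by (simp add: f' vec_eq_iff forall_2)
  then show "\<exists>v. act x1 v \<noteq> 0" by metis
qed

text \<open>The last identity is \<open>(x2 - l)^2 = 0\<close>, phrased as: \<open>x2 - l\<close>
  maps into the eigenspace for \<open>l\<close>.\<close>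

lemma rep_iso_JordanD:
  assumes "rep_iso scale act (*s) (Jordan_rep l)"
  shows "act x1 v = 0" "\<exists>v. v \<noteq> 0 \<and> act x2 v = scale l v"
    "act x2 (act x2 v - scale l v) = scale l (act x2 v - scale l v)"
proof -
  obtain f where lin: "Vector_Spaces.linear scale (*s) f" and "bij f"
    and f: "\<And>b' v. f (act b' v) = Jordan_rep l b' (f v)"
    using rep_isoE[OF assms] by blast
  interpret l: Vector_Spaces.linear scale "(*s)" f by (rule lin)
  note f' = f[unfolded Jordan_rep_def] mat_rep_gens[OF relations_Jordan] mat2_mult_vec
  have "f (act x1 v) = f 0"
    by (simp add: f')
  then show "act x1 v = 0"
    using \<open>bij f\<close> by (metis bij_pointE)
  have "f (act x2 (act x2 v - scale l v)) = f (scale l (act x2 v - scale l v))"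
    by (simp only: l.scale l.diff f') (simp add: vec_eq_iff forall_2 algebra_simps)
  then show "act x2 (act x2 v - scale l v) = scale l (act x2 v - scale l v)"
    using \<open>bij f\<close> by (metis bij_pointE)
  obtain v where v: "f v = vector [1, 0]"
    using \<open>bij f\<close> by (metis bij_pointE)
  then have "f v \<noteq> f 0"
    by (simp add: vec_eq_iff forall_2)
  moreover have "f (act x2 v) = f (scale l v)"
    by (simp add: l.scale f' v vec_eq_iff forall_2)
  then have "act x2 v = scale l v"
    using \<open>bij f\<close> by (metis bij_pointE)
  ultimately show "\<exists>v. v \<noteq> 0 \<and> act x2 v = scale l v" by metis
qed

section \<open>Uniqueness of parameters, and separation of \<open>U\<close> from
  \<open>V\<close>\<close>

text \<open>On the image of \<open>x1\<close> the term with \<open>b\<close> dies because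
  \<open>x1\<close> squares to zero, which determines \<open>a\<close>; evaluation at
  \<open>v\<close> then determines \<open>b\<close>.\<close>

lemma rep_iso_U_unique:
  assumes "rep_iso scale act (*s) (U_rep a b)" "rep_iso scale act (*s) (U_rep a' b')"
  shows "a = a' \<and> b = b'"
proof -
  note U = rep_iso_UD[OF assms(1)] and U' = rep_iso_UD[OF assms(2)]
  obtain v where v: "act x1 v \<noteq> 0"
    using U(1) by blast
  have "act x2 (act x1 v) = scale a (act x1 v)" "act x2 (act x1 v) = scale a' (act x1 v)"
    using U(2)[of "act x1 v"] U'(2)[of "act x1 v"] by simp_all
  then have "a = a'" using v by simp
  then have "scale b (act x1 v) = scale b' (act x1 v)"
    using U(2)[of v] U'(2)[of v] by (metis add_left_cancel)
  then show ?thesis using v \<open>a = a'\<close> by simp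
qed

text \<open>The image of \<open>x1\<close> singles out the eigenvalue \<open>a\<close> of
  \<open>x2\<close> from the pair \<open>a\<close>, \<open>- a\<close>.\<close>

lemma rep_iso_V_unique:
  assumes "rep_iso scale act (*s) (V_rep a)" "rep_iso scale act (*s) (V_rep a')"
  shows "a = a'"
proof -
  obtain v where v: "act x1 v \<noteq> 0"
    using rep_iso_VD(1)[OF assms(1)] by blast
  have "scale a (act x1 v) = scale a' (act x1 v)"
    using rep_iso_VD(2)[OF assms(1), of v] rep_iso_VD(2)[OF assms(2), of v] by metis
  with v show ?thesis by simp
qed

text \<open>For an eigenvector \<open>v\<close> with eigenvalue \<open>l\<close>, the vector
  \<open>x2 v - l' v\<close> is \<open>(l - l') v\<close> and lies in the eigenspace for
  \<open>l'\<close>, so \<open>(l - l')^2 = 0\<close>.\<close>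

lemma rep_iso_Jordan_unique:
  assumes "rep_iso scale act (*s) (Jordan_rep l)" "rep_iso scale act (*s) (Jordan_rep l')"
  shows "l = l'"
proof -
  obtain v where v: "v \<noteq> 0" "act x2 v = scale l v"
    using rep_iso_JordanD(2)[OF assms(1)] by blast
  have "act x2 (scale (l - l') v) = scale l' (scale (l - l') v)"
    using rep_iso_JordanD(3)[OF assms(2), of v] v by (simp add: scale_left_diff_distrib)
  then have "scale ((l - l') * l) v = scale (l' * (l - l')) v"
    by (simp only: act_scale v scale_scale)
  with v have "(l - l') * l = l' * (l - l')"
    by (simp only: scale_cancel_right) simp
  then have "(l - l') * (l - l') = 0"
    by (simp add: algebra_simps)
  then show ?thesis by simp
qed

text \<open>The generators commute on \<open>U\<close> and anticommute on \<open>V\<close>, which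
  would force \<open>2 * a' = 0\<close>.\<close>

lemma not_rep_iso_U_and_V:
  assumes "(2 :: 'k) \<noteq> 0" "a' \<noteq> 0" "rep_iso scale act (*s) (U_rep a b)"
  shows "\<not> rep_iso scale act (*s) (V_rep a')"
proof
  assume V: "rep_iso scale act (*s) (V_rep a')"
  obtain v where v: "act x1 v \<noteq> 0"
    using rep_iso_UD(1)[OF assms(3)] by blast
  have "act x2 (act x1 v) = act x1 (act x2 v)"
    by (simp add: rep_iso_UD(2)[OF assms(3)])
  then have "scale a' (act x1 v) = scale (- a') (act x1 v)"
    using rep_iso_VD(2,3)[OF V] by metis
  with v have "a' = - a'"
    by (simp only: scale_cancel_right) blast
  then have "2 * a' = 0"
    by (simp only: eq_neg_iff_add_eq_0 mult_2)
  with assms show False by simp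
qed

section \<open>Eigenvectors from roots of quadratics\<close>

text \<open>If \<open>v\<close> is not an eigenvector, then \<open>v\<close> and
  \<open>act b v\<close> form a basis and \<open>b\<close> satisfies a monic quadratic there.
  Algebraic closedness enters as \<open>root\<close>, since the context fixes only a field.\<close>

lemma eigenvector_exists:
  assumes dim: "dim (UNIV :: 'v set) = 2"
    and root: "\<And>p q :: 'k. \<exists>z. z * z = p * z + q"
  shows "\<exists>v l. v \<noteq> 0 \<and> act b v = scale l v"
proof -
  have "\<exists>v::'v. v \<noteq> 0"
  proof (rule ccontr)
    assume "\<nexists>v::'v. v \<noteq> 0"
    then have "dim (UNIV :: 'v set) \<le> card ({} :: 'v set)"
      by (intro dim_le_card) auto
    with dim show False by simp
  qed
  then obtain v :: 'v where v: "v \<noteq> 0" by blast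
  show ?thesis
  proof (cases "\<exists>l. act b v = scale l v")
    case True
    with v show ?thesis by blast
  next
    case False
    then have bij: "bij (lincomb v (act b v))"
      using dim v by (intro bij_lincomb) auto
    obtain q p where T: "act b (act b v) = scale q v + scale p (act b v)"
      using lincombE[OF bij] by blast
    obtain z where z: "z * z = p * z + q"
      using root by blast
    \<comment> \<open>The roots of \<open>t^2 - p t - q\<close> are \<open>z\<close> and
      \<open>p - z\<close>; applying the factor of the second root to \<open>v\<close> leaves an
      eigenvector for \<open>z\<close>.\<close>
    define w where "w = act b v - scale (p - z) v"
    have "w \<noteq> 0"
      using False by (auto simp: w_def)
    have q: "q = - z * (p - z)"
      using z by (simp add: algebra_simps)
    have "act b w = scale q v + scale z (act b v)"
      by (simp add: w_def T algebra_simps)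
    then have "act b w = scale z w"
      unfolding q by (simp add: w_def algebra_simps)
    with \<open>w \<noteq> 0\<close> show ?thesis by blast
  qed
qed

end

lemma alg_closed_quadratic_root:
  fixes p q :: "'k::alg_closed_field"
  shows "\<exists>z. z * z = p * z + q"
proof -
  have "\<exists>z. poly [:- q, - p, 1:] z = 0"
    by (rule alg_closed_imp_poly_has_root) simp
  moreover have "poly [:- q, - p, 1:] z = z * z - (p * z + q)" for z
    by (simp add: algebra_simps)
  ultimately show ?thesis
    by (metis right_minus_eq)
qed

section \<open>Exactly one family, with a unique parameter\<close>

text \<open>Pure logic: it splits the final disjunction into existence, uniqueness within each
  family, and pairwise exclusion.\<close>

lemma exactly_one_unique:
  assumes "(\<exists>x. P x) \<or> (\<exists>y. Q y) \<or> (\<exists>z. R z)"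
    and "\<And>x x'. P x \<Longrightarrow> P x' \<Longrightarrow> x = x'" "\<And>y y'. Q y \<Longrightarrow> Q y' \<Longrightarrow> y = y'"
      "\<And>z z'. R z \<Longrightarrow> R z' \<Longrightarrow> z = z'"
    and "\<And>x y. P x \<Longrightarrow> \<not> Q y" "\<And>x z. P x \<Longrightarrow> \<not> R z" "\<And>y z. Q y \<Longrightarrow> \<not> R z"
  shows "(\<exists>!x. P x) \<and> (\<nexists>y. Q y) \<and> (\<nexists>z. R z) \<or>
    (\<exists>!y. Q y) \<and> (\<nexists>x. P x) \<and> (\<nexists>z. R z) \<or>
    (\<exists>!z. R z) \<and> (\<nexists>x. P x) \<and> (\<nexists>y. Q y)"
  using assms(1)
proof (elim disjE)
  assume ex: "\<exists>x. P x"
  then have "\<exists>!x. P x"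
    using assms(2) by blast
  with ex show ?thesis
    using assms(5,6) by blast
next
  assume ex: "\<exists>y. Q y"
  then have "\<exists>!y. Q y"
    using assms(3) by blast
  with ex show ?thesis
    using assms(5,7) by blast
next
  assume ex: "\<exists>z. R z"
  then have "\<exists>!z. R z"
    using assms(4) by blast
  with ex show ?thesis
    using assms(6,7) by blast
qed

theorem theorem3p2:
  fixes scale :: "'k::{alg_closed_field, field_char_0} \<Rightarrow> 'v::ab_group_add \<Rightarrow> 'v"
    and act :: "'k sjp \<Rightarrow> 'v \<Rightarrow> 'v"
  assumes "sjp_rep scale act"
    and "vector_space.dim scale (UNIV :: 'v set) = 2"
    and "sjp_rep.indecomposable scale act"
  shows
    "(\<exists>!ab. rep_iso scale act (*s) (U_rep (fst ab) (snd ab))) \<and>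
       (\<nexists>a. a \<noteq> 0 \<and> rep_iso scale act (*s) (V_rep a)) \<and>
       (\<nexists>l. rep_iso scale act (*s) (Jordan_rep l))
     \<or> (\<exists>!a. a \<noteq> 0 \<and> rep_iso scale act (*s) (V_rep a)) \<and>
       (\<nexists>ab. rep_iso scale act (*s) (U_rep (fst ab) (snd ab))) \<and>
       (\<nexists>l. rep_iso scale act (*s) (Jordan_rep l))
     \<or> (\<exists>!l. rep_iso scale act (*s) (Jordan_rep l)) \<and>
       (\<nexists>ab. rep_iso scale act (*s) (U_rep (fst ab) (snd ab))) \<and>
       (\<nexists>a. a \<noteq> 0 \<and> rep_iso scale act (*s) (V_rep a))"
proof -
  interpret sjp_rep scale act by (rule assms(1))
  let ?U = "\<lambda>ab. rep_iso scale act (*s) (U_rep (fst ab) (snd ab))"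
  let ?V = "\<lambda>a. rep_iso scale act (*s) (V_rep a)"
  let ?J = "\<lambda>l. rep_iso scale act (*s) (Jordan_rep l)"
  have "(\<exists>ab. ?U ab) \<or> (\<exists>a. a \<noteq> 0 \<and> ?V a) \<or> (\<exists>l. ?J l)"
  proof (cases "\<exists>v. act x1 v \<noteq> 0")
    case True
    then show ?thesis
      using rep_iso_U_or_V[OF assms(2)] by auto
  next
    case False
    then have x1: "act x1 v = 0" for v
      by simp
    obtain e l where "e \<noteq> 0" "act x2 e = scale l e"
      using eigenvector_exists[OF assms(2) alg_closed_quadratic_root, of x2] by metis
    then show ?thesis
      using rep_iso_Jordan[OF assms(2,3) x1] by metis
  qed
  then show ?thesis
  proof (rule exactly_one_unique)
    show "ab = ab'" if "?U ab" "?U ab'" for ab ab'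
      using rep_iso_U_unique that by (metis prod_eqI)
    show "a = a'" if "a \<noteq> 0 \<and> ?V a" "a' \<noteq> 0 \<and> ?V a'" for a a'
      using rep_iso_V_unique that by simp
    show "l = l'" if "?J l" "?J l'" for l l'
      using rep_iso_Jordan_unique that .
    show "\<not> (a \<noteq> 0 \<and> ?V a)" if "?U ab" for a ab
      using not_rep_iso_U_and_V[OF _ _ that] by auto
    \<comment> \<open>\<open>x1\<close> acts nontrivially on \<open>U\<close> and on
      \<open>V\<close> but by zero on a Jordan block.\<close>
    show "\<not> ?J l" if "?U ab" for l ab
      using rep_iso_UD(1)[OF that] rep_iso_JordanD(1) by blast
    show "\<not> ?J l" if "a \<noteq> 0 \<and> ?V a" for l a
      using rep_iso_VD(1) that rep_iso_JordanD(1) by blast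
  qed
qed

end
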